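(* Let $d>1$ be an integer. The following divisibilities hold: (1) If $2\nmid d$, then $d\mid\frac{D_{md+2}^{(e)}}{md+1}$ and $d\mid\frac{D_{md+3}^{(o)}}{md+2}$ for all $m\in\mathbb{N}$. In particular, $d(md+1)\mid D_{md+2}^{(e)}$ and $d(md+2)\mid D_{md+3}^{(o)}$. (2) If $2\mid d$, then $d\mid\frac{D_{2md+2}^{(e)}}{2md+1}$ and $d\mid\frac{D_{2md+3}^{(o)}}{2md+2}$ for all $m\in\mathbb{N}$. In particular, $d(2md+1)\mid D_{2md+2}^{(e)}$ and $d(2md+2)\mid D_{2md+3}^{(o)}$.
   Context: $\mathbb{N}=\{0,1,2,\dots\}$. $D_n^{(e)}$ (respectively $D_n^{(o)}$) is the number of even (respectively odd) permutations of an $n$-element set without fixed points. They satisfy $D_0^{(e)}=1$, $D_1^{(e)}=0$, $D_0^{(o)}=0$, $D_1^{(o)}=0$, and $D_n^{(e)}=(n-1)(D_{n-2}^{(o)}+D_{n-1}^{(o)})$, $D_n^{(o)}=(n-1)(D_{n-2}^{(e)}+D_{n-1}^{(e)})$ for $n\ge2$; in particular $n-1$ divides both $D_n^{(e)}$ and $D_n^{(o)}$. *)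

theory Defs
  imports Main "HOL-Combinatorics.Permutations"
begin

definition derangements :: "'a set \<Rightarrow> ('a \<Rightarrow> 'a) set" where
  "derangements A = {p. p permutes A \<and> (\<forall>x\<in>A. p x \<noteq> x)}"

definition even_derangement_number :: "nat \<Rightarrow> nat" where
  "even_derangement_number n = card {p \<in> derangements {..<n}. evenperm p}"

definition odd_derangement_number :: "nat \<Rightarrow> nat" where
  "odd_derangement_number n = card {p \<in> derangements {..<n}. \<not> evenperm p}"

end

theory Submission
  imports Defs
begin

(* Write a derangement p of insert a S as transpose a b o q with b = p a. Then q permutes S and has
   no fixed point except possibly b, so q is a derangement of S or of S - {b}; the sign flips. This
   gives the recurrences for the numbers E(n), O(n) of even and odd derangements. From them,
   E(n) - O(n) = (-1)^n (1 - n), and D(n) = E(n) + O(n) satisfies D(n+1) = (n+1) D(n) - (-1)^n.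
   If k divides N, the last identity gives D(N) = (-1)^N, D(N+1) = 0 and D(N+2) = (-1)^N modulo k,
   so k divides 2 (O(N) + O(N+1)) and 2 (E(N+1) + E(N+2)). Take k = d if d is odd and k = 2 d
   if d is even, to cancel the factor 2. *)

section \<open>Splitting off one point of a derangement\<close>

lemma derangements_insert:
  assumes "a \<notin> S"
  shows "derangements (insert a S) =
    (\<lambda>(b, q). transpose a b \<circ> q) ` (SIGMA b:S. derangements S \<union> derangements (S - {b}))"
    (is "?L = ?f ` ?R")
proof (intro equalityI subsetI)
  fix p assume "p \<in> ?L"
  then have p: "p permutes insert a S" and nofix: "\<And>x. x \<in> insert a S \<Longrightarrow> p x \<noteq> x"
    by (auto simp: derangements_def)
  define b where "b = p a"
  \<comment> \<open>Since \<open>p a = b\<close>, this \<open>q\<close> fixes \<open>a\<close>; the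
    transposition is an involution, so it also recovers \<open>p\<close> from
    \<open>q\<close>.\<close>
  define q where "q = transpose a b \<circ> p"
  have b: "b \<in> S"
    using permutes_in_image[OF p, of a] nofix[of a] by (auto simp: b_def)
  have q: "q permutes S"
    unfolding q_def b_def using permutes_insert_lemma[OF p] .
  have q_nofix: "q x \<noteq> x" if "x \<in> S" "x \<noteq> b" for x
    using that nofix[of x] assms by (auto simp: q_def transpose_def)
  have "q \<in> derangements S \<union> derangements (S - {b})"
  \<comment> \<open>\<open>q b = b\<close> means \<open>p b = a\<close>, that is, \<open>a\<close>
    and \<open>b\<close> form a 2-cycle of \<open>p\<close>.\<close>
  proof (cases "q b = b")
    case True
    then have "q permutes S - {b}"
      using q by (intro permutes_superset[OF q]) auto
    then show ?thesis
      using q_nofix by (auto simp: derangements_def)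
  next
    case False
    then have "\<forall>x\<in>S. q x \<noteq> x" using q_nofix by metis
    then show ?thesis
      using q by (auto simp: derangements_def)
  qed
  moreover have "p = ?f (b, q)"
    by (auto simp: q_def fun_eq_iff)
  ultimately show "p \<in> ?f ` ?R"
    using b by blast
next
  fix p assume "p \<in> ?f ` ?R"
  then obtain b q where b: "b \<in> S" and p: "p = transpose a b \<circ> q"
    and q: "q \<in> derangements S \<union> derangements (S - {b})"
    by auto
  have qS: "q permutes S"
    using q by (auto simp: derangements_def intro: permutes_subset)
  have q_nofix: "q x \<noteq> x" if "x \<in> S" "x \<noteq> b" for x
    using q that by (auto simp: derangements_def)
  have "p permutes insert a S"
    unfolding p using b by (intro permutes_compose permutes_subset[OF qS] permutes_swap_id) auto
  moreover have "p x \<noteq> x" if "x \<in> insert a S" for x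
  proof (cases "x = a")
    case True
    have "q a = a" using qS assms by (auto simp: permutes_not_in)
    then show ?thesis using True b assms by (auto simp: p)
  next
    case False
    then have "x \<in> S" using that by simp
    \<comment> \<open>If \<open>q x = b\<close>, then \<open>p x = a\<close>, which lies outside
      \<open>S\<close>. Otherwise \<open>q x\<close> avoids both \<open>a\<close> and
      \<open>b\<close>, so \<open>p x = q x\<close>, which is not \<open>x\<close>: for
      \<open>x = b\<close> by the case assumption, for other \<open>x\<close> by
      \<open>q_nofix\<close>.\<close>
    then have "q x \<in> S" using permutes_in_image[OF qS] by simp
    then show ?thesis
      using \<open>x \<in> S\<close> q_nofix[of x] b assms by (auto simp: p transpose_def)
  qed
  ultimately show "p \<in> ?L"
    by (auto simp: derangements_def)
qed

text \<open>Each \<open>q\<close> fixes \<open>a\<close>, so the composite sends \<open>a\<close> to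
  \<open>b\<close>. This determines \<open>b\<close>, and the transposition can then be
  cancelled.\<close>

lemma inj_on_transpose_comp:
  assumes "a \<notin> S" "\<And>b q. (b, q) \<in> R \<Longrightarrow> q permutes S"
  shows "inj_on (\<lambda>(b, q). transpose a b \<circ> q) R"
proof (rule inj_onI, clarify)
  fix b q b' q'
  assume bq: "(b, q) \<in> R" "(b', q') \<in> R"
    and eq: "transpose a b \<circ> q = transpose a b' \<circ> q'"
  have "q a = a" "q' a = a"
    using bq assms by (auto intro: permutes_not_in)
  then have "b = b'"
    using fun_cong[OF eq, of a] by simp
  moreover have "q x = q' x" for x
    using fun_cong[OF eq, of x] \<open>b = b'\<close> by (metis comp_apply transpose_involutory)
  ultimately show "b = b' \<and> q = q'" by auto
qed

section \<open>Counting derangements by sign\<close>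

text \<open>A Boolean sign (\<open>True\<close> for even) lets one recurrence serve both parities;
  arbitrary sets are allowed because the recurrence passes to \<open>S - {b}\<close>.\<close>

definition signed_derangement_number :: "bool \<Rightarrow> 'a set \<Rightarrow> nat" where
  "signed_derangement_number s A = card {p \<in> derangements A. evenperm p = s}"

lemma finite_derangements: "finite A \<Longrightarrow> finite (derangements A)"
  by (rule finite_subset[OF _ finite_permutations[of A]]) (auto simp: derangements_def)

text \<open>The transposition reverses parity, so \<open>derangements_insert\<close> restricts to a
  bijection between one sign and pairs of the opposite sign; these are counted separately for each
  \<open>b\<close>.\<close>

lemma signed_derangement_number_insert:
  assumes "finite S" "a \<notin> S"
  shows "signed_derangement_number s (insert a S) =
    (\<Sum>b\<in>S. signed_derangement_number (\<not> s) S + signed_derangement_number (\<not> s) (S - {b}))"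
proof -
  let ?D = "\<lambda>T. {q \<in> derangements T. evenperm q = (\<not> s)}"
  let ?f = "\<lambda>(b, q). transpose a b \<circ> q"
  let ?R = "SIGMA b:S. ?D S \<union> ?D (S - {b})"
  have fin: "finite (?D T)" if "finite T" for T
    by (rule finite_subset[OF _ finite_derangements[OF that]]) auto
  have perm: "q permutes S" if "q \<in> derangements S \<union> derangements (S - {b})" for b q
    using that by (auto simp: derangements_def intro: permutes_subset)
  have ev: "evenperm (transpose a b \<circ> q) = (\<not> evenperm q)"
    if "b \<in> S" "q \<in> derangements S \<union> derangements (S - {b})" for b q
  proof -
    have "permutation q"
      using perm[OF that(2)] assms(1) permutation_permutes by blast
    moreover have "a \<noteq> b" using that assms by auto
    ultimately show ?thesis
      by (simp add: evenperm_comp permutation_swap_id evenperm_swap)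
  qed
  have img: "{p \<in> derangements (insert a S). evenperm p = s} = ?f ` ?R"
  proof (intro equalityI subsetI)
    fix p assume p: "p \<in> {p \<in> derangements (insert a S). evenperm p = s}"
    then obtain b q where bq: "b \<in> S" "q \<in> derangements S \<union> derangements (S - {b})"
      "p = ?f (b, q)"
      using derangements_insert[OF assms(2)] by auto
    then have "(b, q) \<in> ?R" using p ev[OF bq(1,2)] by auto
    then show "p \<in> ?f ` ?R" using bq(3) by blast
  next
    fix p assume "p \<in> ?f ` ?R"
    then obtain b q where bq: "b \<in> S" "q \<in> ?D S \<union> ?D (S - {b})" "p = ?f (b, q)"
      by auto
    then have q: "q \<in> derangements S \<union> derangements (S - {b})" and "evenperm q = (\<not> s)" by auto
    then have "evenperm p = s" using ev[OF bq(1) q] bq(3) by auto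
    moreover have "p \<in> derangements (insert a S)"
      unfolding derangements_insert[OF assms(2)] using bq(1,3) q by blast
    ultimately show "p \<in> {p \<in> derangements (insert a S). evenperm p = s}" by simp
  qed
  have "inj_on ?f ?R"
    by (rule inj_on_transpose_comp[OF assms(2)]) (use perm in auto)
  then have "signed_derangement_number s (insert a S) = card ?R"
    unfolding signed_derangement_number_def img by (rule card_image)
  also have "\<dots> = (\<Sum>b\<in>S. card (?D S \<union> ?D (S - {b})))"
    using assms(1) by (intro card_SigmaI) (auto intro!: fin)
  also have "\<dots> = (\<Sum>b\<in>S. card (?D S) + card (?D (S - {b})))"
  proof (rule sum.cong[OF refl])
    fix b assume "b \<in> S"
    \<comment> \<open>A permutation of \<open>S - {b}\<close> fixes \<open>b\<close>, which a
      derangement of \<open>S\<close> must move.\<close>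
    have "\<not> (q \<in> derangements S \<and> q \<in> derangements (S - {b}))" for q
    proof
      assume *: "q \<in> derangements S \<and> q \<in> derangements (S - {b})"
      then have "q b = b" by (auto simp: derangements_def intro: permutes_not_in)
      then show False using * \<open>b \<in> S\<close> by (auto simp: derangements_def)
    qed
    then have "?D S \<inter> ?D (S - {b}) = {}" by auto
    then show "card (?D S \<union> ?D (S - {b})) = card (?D S) + card (?D (S - {b}))"
      using assms(1) by (intro card_Un_disjoint) (auto intro!: fin)
  qed
  finally show ?thesis
    by (simp add: signed_derangement_number_def)
qed

text \<open>The value at 0 accounts for the identity on the empty set, an even derangement.\<close>

fun signed_subfactorial :: "bool \<Rightarrow> nat \<Rightarrow> nat" where
  "signed_subfactorial s 0 = of_bool s"
| "signed_subfactorial s (Suc 0) = 0"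
| "signed_subfactorial s (Suc (Suc n)) =
     Suc n * (signed_subfactorial (\<not> s) (Suc n) + signed_subfactorial (\<not> s) n)"

lemma signed_derangement_number_eq:
  assumes "finite A"
  shows "signed_derangement_number s A = signed_subfactorial s (card A)"
  using assms
proof (induction "card A" arbitrary: A s rule: less_induct)
  case less
  show ?case
  proof (cases "A = {}")
    case True
    have "{p \<in> derangements A. evenperm p = s} = (if s then {id} else {})"
      using True by (auto simp: derangements_def evenperm_id)
    then show ?thesis
      using True by (simp add: signed_derangement_number_def)
  next
    case False
    then obtain a S where A: "A = insert a S" "a \<notin> S"
      by (meson Set.set_insert all_not_in_conv)
    then have S: "finite S" "card A = Suc (card S)" using less.prems by auto
    have "signed_derangement_number s A =
      (\<Sum>b\<in>S. signed_subfactorial (\<not> s) (card S) + signed_subfactorial (\<not> s) (card S - 1))"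
      unfolding A(1) signed_derangement_number_insert[OF S(1) A(2)]
      by (rule sum.cong) (use S less.hyps in \<open>auto simp: card_Diff_singleton\<close>)
    \<comment> \<open>If \<open>card S = 0\<close> the sum is empty, so the truncated
      \<open>card S - 1\<close> does no harm and the value is 0; otherwise all summands agree and
      give the factor \<open>card S\<close>.\<close>
    then show ?thesis
      using S(2) by (cases "card S") auto
  qed
qed

lemma even_derangement_number_eq: "even_derangement_number n = signed_subfactorial True n"
  using signed_derangement_number_eq[of "{..<n}" True]
  by (simp add: signed_derangement_number_def even_derangement_number_def)

lemma odd_derangement_number_eq: "odd_derangement_number n = signed_subfactorial False n"
  using signed_derangement_number_eq[of "{..<n}" False]
  by (simp add: signed_derangement_number_def odd_derangement_number_def)

section \<open>Difference and sum of the two counts\<close>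

text \<open>The sign flip turns the recurrence into one for the difference alone, with factor
  \<open>- (n + 1)\<close>; the closed form satisfies it and has the initial values 1 and 0.\<close>

lemma signed_subfactorial_diff:
  "int (signed_subfactorial True n) - int (signed_subfactorial False n) = (-1) ^ n * (1 - int n)"
proof (induction n rule: induct_nat_012)
  case (ge2 n)
  have "int (signed_subfactorial True (Suc (Suc n))) - int (signed_subfactorial False (Suc (Suc n)))
    = - int (Suc n) * ((int (signed_subfactorial True (Suc n)) - int (signed_subfactorial False (Suc n)))
       + (int (signed_subfactorial True n) - int (signed_subfactorial False n)))"
    by (simp add: algebra_simps)
  then show ?case
    unfolding ge2 by (simp add: algebra_simps)
qed auto

text \<open>Integer-valued, so that alternating terms can be subtracted.\<close>

definition subfactorial :: "nat \<Rightarrow> int" where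
  "subfactorial n = int (signed_subfactorial True n) + int (signed_subfactorial False n)"

lemma subfactorial_Suc: "subfactorial (Suc n) = int (Suc n) * subfactorial n - (-1) ^ n"
proof (induction n)
  case 0
  then show ?case by (simp add: subfactorial_def)
next
  case (Suc n)
  have "subfactorial (Suc (Suc n)) = int (Suc n) * (subfactorial (Suc n) + subfactorial n)"
    by (simp add: subfactorial_def algebra_simps)
  \<comment> \<open>The induction hypothesis is read backwards, replacing
    \<open>(n + 1) * subfactorial n\<close>.\<close>
  also have "\<dots> = int (Suc n) * subfactorial (Suc n) + (subfactorial (Suc n) + (-1) ^ n)"
    by (simp add: Suc.IH algebra_simps)
  finally show ?case by (simp add: algebra_simps)
qed

section \<open>Divisibility\<close>

text \<open>The factor 2 arises from recovering one parity from the sum and the difference of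
  both.\<close>

lemma dvd_twice_signed_subfactorial_sums:
  fixes k N :: nat
  assumes "k dvd N"
  shows "k dvd 2 * (signed_subfactorial False N + signed_subfactorial False (N + 1))"
    and "k dvd 2 * (signed_subfactorial True (N + 1) + signed_subfactorial True (N + 2))"
proof -
  have D0: "int k dvd subfactorial N - (-1) ^ N"
  \<comment> \<open>A positive \<open>N\<close> is a factor by \<open>subfactorial_Suc\<close>; for
    \<open>N = 0\<close> the difference is \<open>1 - 1 = 0\<close>.\<close>
  proof (cases N)
    case (Suc n)
    then have "subfactorial N - (-1) ^ N = int N * subfactorial n"
      using subfactorial_Suc[of n] by simp
    then show ?thesis using assms by simp
  qed (simp add: subfactorial_def)
  have "subfactorial (N + 1) = int N * subfactorial N + (subfactorial N - (-1) ^ N)"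
    using subfactorial_Suc[of N] by (simp add: algebra_simps)
  then have D1: "int k dvd subfactorial (N + 1)"
    using D0 assms by simp
  have "subfactorial (N + 2) - (-1) ^ N = int (N + 2) * subfactorial (N + 1)"
    using subfactorial_Suc[of "N + 1"] by simp
  then have D2: "int k dvd subfactorial (N + 2) - (-1) ^ N"
    using D1 by simp
  \<comment> \<open>Twice an odd count is the sum minus the difference of both parities; the
    differences at \<open>N\<close> and \<open>N + 1\<close> add up to
    \<open>(-1) ^ N\<close>.\<close>
  have "int (2 * (signed_subfactorial False N + signed_subfactorial False (N + 1)))
      = (subfactorial N - (-1) ^ N) + subfactorial (N + 1)"
    using signed_subfactorial_diff[of N] signed_subfactorial_diff[of "N + 1"]
    by (simp add: subfactorial_def algebra_simps del: signed_subfactorial.simps)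
  then have "int k dvd int (2 * (signed_subfactorial False N + signed_subfactorial False (N + 1)))"
    using D0 D1 by (metis dvd_add)
  then show "k dvd 2 * (signed_subfactorial False N + signed_subfactorial False (N + 1))"
    by (simp only: int_dvd_int_iff)
  \<comment> \<open>Twice an even count is the sum plus the difference; the differences at
    \<open>N + 1\<close> and \<open>N + 2\<close> add up to \<open>- ((-1) ^ N)\<close>.\<close>
  have "int (2 * (signed_subfactorial True (N + 1) + signed_subfactorial True (N + 2)))
      = subfactorial (N + 1) + (subfactorial (N + 2) - (-1) ^ N)"
    using signed_subfactorial_diff[of "N + 1"] signed_subfactorial_diff[of "N + 2"]
    by (simp add: subfactorial_def algebra_simps del: signed_subfactorial.simps)
  then have "int k dvd int (2 * (signed_subfactorial True (N + 1) + signed_subfactorial True (N + 2)))"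
    using D1 D2 by (metis dvd_add)
  then show "k dvd 2 * (signed_subfactorial True (N + 1) + signed_subfactorial True (N + 2))"
    by (simp only: int_dvd_int_iff)
qed

text \<open>The assumption covers both parts of the theorem, with \<open>N = m * d\<close> and
  \<open>N = 2 * m * d\<close>.\<close>

lemma derangement_number_dvd:
  fixes d N :: nat
  assumes "odd d \<and> d dvd N \<or> 2 * d dvd N"
  shows "d dvd even_derangement_number (N + 2) div (N + 1)"
    and "d dvd odd_derangement_number (N + 3) div (N + 2)"
    and "d * (N + 1) dvd even_derangement_number (N + 2)"
    and "d * (N + 2) dvd odd_derangement_number (N + 3)"
proof -
  have cancel: "d dvd x" if "\<And>k. k dvd N \<Longrightarrow> k dvd 2 * x" for x
    using assms
  proof
    assume "odd d \<and> d dvd N"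
    moreover from this have "coprime d 2" by simp
    ultimately show ?thesis using that[of d] by (simp add: coprime_dvd_mult_right_iff)
  next
    assume "2 * d dvd N"
    then show ?thesis using that[of "2 * d"] by simp
  qed
  define x where "x = signed_subfactorial False N + signed_subfactorial False (N + 1)"
  define y where "y = signed_subfactorial True (N + 1) + signed_subfactorial True (N + 2)"
  have x: "d dvd x" and y: "d dvd y"
    unfolding x_def y_def by (intro cancel dvd_twice_signed_subfactorial_sums; assumption)+
  \<comment> \<open>The recurrence splits off the factor \<open>N + 1\<close>, so the division is
    exact with quotient \<open>x\<close>; likewise \<open>y\<close> for the odd count.\<close>
  have ex: "even_derangement_number (N + 2) = x * (N + 1)"
    by (simp add: even_derangement_number_eq x_def numeral_2_eq_2 algebra_simps)
  have oy: "odd_derangement_number (N + 3) = y * (N + 2)"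
    by (simp add: odd_derangement_number_eq y_def numeral_3_eq_3 numeral_2_eq_2 algebra_simps)
  show "d dvd even_derangement_number (N + 2) div (N + 1)"
    unfolding ex using x by (subst nonzero_mult_div_cancel_right) auto
  show "d dvd odd_derangement_number (N + 3) div (N + 2)"
    unfolding oy using y by (subst nonzero_mult_div_cancel_right) auto
  show "d * (N + 1) dvd even_derangement_number (N + 2)"
    unfolding ex using x by (rule mult_dvd_mono) simp
  show "d * (N + 2) dvd odd_derangement_number (N + 3)"
    unfolding oy using y by (rule mult_dvd_mono) simp
qed

theorem proposition23:
  fixes d :: nat
  assumes "d > 1"
  shows "(\<not> 2 dvd d \<longrightarrow> (\<forall>m::nat.
           d dvd even_derangement_number (m * d + 2) div (m * d + 1) \<and>
           d dvd odd_derangement_number (m * d + 3) div (m * d + 2) \<and>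
           d * (m * d + 1) dvd even_derangement_number (m * d + 2) \<and>
           d * (m * d + 2) dvd odd_derangement_number (m * d + 3))) \<and>
         (2 dvd d \<longrightarrow> (\<forall>m::nat.
           d dvd even_derangement_number (2 * m * d + 2) div (2 * m * d + 1) \<and>
           d dvd odd_derangement_number (2 * m * d + 3) div (2 * m * d + 2) \<and>
           d * (2 * m * d + 1) dvd even_derangement_number (2 * m * d + 2) \<and>
           d * (2 * m * d + 2) dvd odd_derangement_number (2 * m * d + 3)))"
proof (intro conjI impI allI)
  fix m :: nat
  assume "\<not> 2 dvd d"
  then have *: "odd d \<and> d dvd m * d \<or> 2 * d dvd m * d" by simp
  show "d dvd even_derangement_number (m * d + 2) div (m * d + 1)"
    "d dvd odd_derangement_number (m * d + 3) div (m * d + 2)"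
    "d * (m * d + 1) dvd even_derangement_number (m * d + 2)"
    "d * (m * d + 2) dvd odd_derangement_number (m * d + 3)"
    using derangement_number_dvd[OF *] by blast+
next
  fix m :: nat
  have *: "odd d \<and> d dvd 2 * m * d \<or> 2 * d dvd 2 * m * d" by simp
  show "d dvd even_derangement_number (2 * m * d + 2) div (2 * m * d + 1)"
    "d dvd odd_derangement_number (2 * m * d + 3) div (2 * m * d + 2)"
    "d * (2 * m * d + 1) dvd even_derangement_number (2 * m * d + 2)"
    "d * (2 * m * d + 2) dvd odd_derangement_number (2 * m * d + 3)"
    using derangement_number_dvd[OF *] by blast+
qed

end
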